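(* Let $\alpha\in(0,1)$, $1<p<\frac n\alpha$. Let $X=X(Q_0)$ and $Y=Y(Q_0)$ be rearrangement invariant spaces such that the local Riesz potential $I_{\alpha,Q_0}$ is bounded from $Y$ to $X$. Then $W^\alpha_{p,Y}\subset GaRo_X$; more precisely, there is a constant $C_n$ (depending on $n,p,\alpha$) such that for every $f\in W^{\alpha}_{p,Y}$ the function $C_nI_{\alpha,Q_0}(D_{p,\alpha}(f))$ belongs to $\Gamma_f^X$ and \[ \|f\|_{GaRo_X}\le C_n\|I_{\alpha,Q_0}\|_{Y\to X}\|f\|_{W^\alpha_{p,Y}}. \]
   Context: $Q_0=(0,1)^n$; cubes are subcubes of $Q_0$ with sides parallel to the axes. $P$ is the set of countable families $\{Q_i\}_{i\in I}$ of subcubes of $Q_0$ with pairwise disjoint interiors. A rearrangement invariant (r.i.) space is a Banach function space $X$ on $Q_0$ such that $g\in X$, $f^*=g^*$ imply $f\in X$, $\|f\|_X=\|g\|_X$ ($f^*$ = decreasing rearrangement). For measurable $f$ on $Q_0$, \[ D_{p,\alpha}(f)(y)=\Big\{\int_{Q_0}\frac{|f(x)-f(y)|^p}{|x-y|^{n+\alpha p}}\,dx\Big\}^{1/p},\ y\in Q_0, \] $W^\alpha_{p,Y}=\{f:\|f\|_{W^\alpha_{p,Y}}:=\|D_{p,\alpha}(f)\|_Y<\infty\}$, and $I_{\alpha,Q_0}(g)(z)=\int_{Q_0}\frac{g(y)}{|z-y|^{n-\alpha}}\,dy$, $z\in Q_0$. An integrable $f$ belongs to $GaRo_X$ if there is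 $\gamma\in X$ such that for all $\{Q_i\}_{i\in I}\in P$, $\sum_i\frac1{|Q_i|}\int_{Q_i}\int_{Q_i}|f(x)-f(y)|\,dx\,dy\le\sum_i\int_{Q_i}\gamma$; $\Gamma_f^X$ is the set of such $\gamma$, and $\|f\|_{GaRo_X}=\inf\{\|\gamma\|_X:\gamma\in\Gamma_f^X\}$. *)

theory Defs
  imports "HOL-Analysis.Analysis"
begin

definition Q0 :: "(real^'n::finite) set" where
  "Q0 = box 0 One"

abbreviation MQ0 :: "(real^'n::finite) measure" where
  "MQ0 \<equiv> lebesgue_on Q0"

text \<open>A Banach function norm (Bennett--Sharpley axioms P1--P5) on nonnegative
  measurable functions on Q0.\<close>

definition function_norm :: "(((real^'n::finite) \<Rightarrow> ennreal) \<Rightarrow> ennreal) \<Rightarrow> bool" where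
  "function_norm \<rho> \<longleftrightarrow>
     (\<forall>f \<in> borel_measurable (MQ0::(real^'n) measure).
        (\<rho> f = 0 \<longleftrightarrow> (AE x in MQ0. f x = 0))) \<and>
     (\<forall>f \<in> borel_measurable (MQ0::(real^'n) measure). \<forall>c::real. c \<ge> 0 \<longrightarrow>
        \<rho> (\<lambda>x. ennreal c * f x) = ennreal c * \<rho> f) \<and>
     (\<forall>f \<in> borel_measurable (MQ0::(real^'n) measure). \<forall>g \<in> borel_measurable MQ0.
        \<rho> (\<lambda>x. f x + g x) \<le> \<rho> f + \<rho> g) \<and>
     (\<forall>f \<in> borel_measurable (MQ0::(real^'n) measure). \<forall>g \<in> borel_measurable MQ0.
        (AE x in MQ0. g x \<le> f x) \<longrightarrow> \<rho> g \<le> \<rho> f) \<and>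
     (\<forall>F f. (\<forall>k. F k \<in> borel_measurable (MQ0::(real^'n) measure)) \<longrightarrow>
        f \<in> borel_measurable MQ0 \<longrightarrow>
        (AE x in MQ0. incseq (\<lambda>k. F k x) \<and> (SUP k. F k x) = f x) \<longrightarrow>
        \<rho> f = (SUP k. \<rho> (F k))) \<and>
     (\<forall>A \<in> sets (MQ0::(real^'n) measure). emeasure MQ0 A < \<infinity> \<longrightarrow>
        \<rho> (indicator A) < \<infinity>) \<and>
     (\<forall>A \<in> sets (MQ0::(real^'n) measure). emeasure MQ0 A < \<infinity> \<longrightarrow>
        (\<exists>C::real. \<forall>f \<in> borel_measurable MQ0.
           set_nn_integral MQ0 A f \<le> ennreal C * \<rho> f))"

definition in_space :: "(((real^'n::finite) \<Rightarrow> ennreal) \<Rightarrow> ennreal) \<Rightarrow> ((real^'n) \<Rightarrow> real) \<Rightarrow> bool" where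
  "in_space \<rho> f \<longleftrightarrow> f \<in> borel_measurable MQ0 \<and> \<rho> (\<lambda>x. ennreal \<bar>f x\<bar>) < \<infinity>"

definition space_norm :: "(((real^'n::finite) \<Rightarrow> ennreal) \<Rightarrow> ennreal) \<Rightarrow> ((real^'n) \<Rightarrow> real) \<Rightarrow> real" where
  "space_norm \<rho> f = enn2real (\<rho> (\<lambda>x. ennreal \<bar>f x\<bar>))"

definition decr_rearr :: "((real^'n::finite) \<Rightarrow> real) \<Rightarrow> real \<Rightarrow> ennreal" where
  "decr_rearr f t =
     Inf {s::ennreal. emeasure lebesgue {x \<in> (Q0::(real^'n) set). s < ennreal \<bar>f x\<bar>} \<le> ennreal t}"

definition ri_space :: "(((real^'n::finite) \<Rightarrow> ennreal) \<Rightarrow> ennreal) \<Rightarrow> bool" where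
  "ri_space \<rho> \<longleftrightarrow> function_norm \<rho> \<and>
     (\<forall>f g. f \<in> borel_measurable MQ0 \<longrightarrow> g \<in> borel_measurable MQ0 \<longrightarrow>
        in_space \<rho> g \<longrightarrow> (\<forall>t\<ge>0. decr_rearr f t = decr_rearr g t) \<longrightarrow>
        in_space \<rho> f \<and> space_norm \<rho> f = space_norm \<rho> g)"

definition enn_powr :: "ennreal \<Rightarrow> real \<Rightarrow> ennreal" where
  "enn_powr x r = (if x = \<infinity> then \<infinity> else ennreal (enn2real x powr r))"

definition D_frac :: "real \<Rightarrow> real \<Rightarrow> ((real^'n::finite) \<Rightarrow> real) \<Rightarrow> (real^'n) \<Rightarrow> ennreal" where
  "D_frac p \<alpha> f y = enn_powr
     (set_nn_integral lebesgue (Q0::(real^'n) set)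
        (\<lambda>x. ennreal (\<bar>f x - f y\<bar> powr p / dist x y powr (real CARD('n) + \<alpha> * p))))
     (1 / p)"

definition in_W :: "(((real^'n::finite) \<Rightarrow> ennreal) \<Rightarrow> ennreal) \<Rightarrow> real \<Rightarrow> real \<Rightarrow> ((real^'n) \<Rightarrow> real) \<Rightarrow> bool" where
  "in_W \<rho> p \<alpha> f \<longleftrightarrow> f \<in> borel_measurable MQ0 \<and> \<rho> (D_frac p \<alpha> f) < \<infinity>"

definition W_norm :: "(((real^'n::finite) \<Rightarrow> ennreal) \<Rightarrow> ennreal) \<Rightarrow> real \<Rightarrow> real \<Rightarrow> ((real^'n) \<Rightarrow> real) \<Rightarrow> real" where
  "W_norm \<rho> p \<alpha> f = enn2real (\<rho> (D_frac p \<alpha> f))"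

definition riesz :: "real \<Rightarrow> ((real^'n::finite) \<Rightarrow> real) \<Rightarrow> (real^'n) \<Rightarrow> real" where
  "riesz \<alpha> g z = set_lebesgue_integral lebesgue (Q0::(real^'n) set)
      (\<lambda>y. g y / dist z y powr (real CARD('n) - \<alpha>))"

definition riesz_bounded :: "real \<Rightarrow> (((real^'n::finite) \<Rightarrow> ennreal) \<Rightarrow> ennreal) \<Rightarrow> (((real^'n) \<Rightarrow> ennreal) \<Rightarrow> ennreal) \<Rightarrow> bool" where
  "riesz_bounded \<alpha> \<rho>Y \<rho>X \<longleftrightarrow>
     (\<exists>K. \<forall>g. in_space \<rho>Y g \<longrightarrow>
        in_space \<rho>X (riesz \<alpha> g) \<and> space_norm \<rho>X (riesz \<alpha> g) \<le> K * space_norm \<rho>Y g)"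

definition riesz_opnorm :: "real \<Rightarrow> (((real^'n::finite) \<Rightarrow> ennreal) \<Rightarrow> ennreal) \<Rightarrow> (((real^'n) \<Rightarrow> ennreal) \<Rightarrow> ennreal) \<Rightarrow> real" where
  "riesz_opnorm \<alpha> \<rho>Y \<rho>X =
     Inf {K. 0 \<le> K \<and> (\<forall>g. in_space \<rho>Y g \<longrightarrow> space_norm \<rho>X (riesz \<alpha> g) \<le> K * space_norm \<rho>Y g)}"

definition subcube :: "(real^'n::finite) set \<Rightarrow> bool" where
  "subcube Q \<longleftrightarrow> (\<exists>a h. 0 < h \<and> Q = box a (a + h *\<^sub>R One) \<and> Q \<subseteq> Q0)"

text \<open>A countable family of subcubes with pairwise disjoint interiors, given as a
  sequence of open subcubes or empty sets (empty entries contribute nothing).\<close>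

definition cube_family :: "(nat \<Rightarrow> (real^'n::finite) set) \<Rightarrow> bool" where
  "cube_family Q \<longleftrightarrow> (\<forall>i. Q i = {} \<or> subcube (Q i)) \<and> disjoint_family Q"

definition GaRo_ineq :: "((real^'n::finite) \<Rightarrow> real) \<Rightarrow> ((real^'n) \<Rightarrow> real) \<Rightarrow> (nat \<Rightarrow> (real^'n) set) \<Rightarrow> bool" where
  "GaRo_ineq f \<gamma> Q \<longleftrightarrow>
     enn2ereal (\<Sum>i. ennreal (1 / measure lebesgue (Q i)) *
        set_nn_integral lebesgue (Q i) (\<lambda>x. set_nn_integral lebesgue (Q i) (\<lambda>y. ennreal \<bar>f x - f y\<bar>)))
     \<le> ereal (\<Sum>i. set_lebesgue_integral lebesgue (Q i) \<gamma>)"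

definition Gamma_set :: "(((real^'n::finite) \<Rightarrow> ennreal) \<Rightarrow> ennreal) \<Rightarrow> ((real^'n) \<Rightarrow> real) \<Rightarrow> ((real^'n) \<Rightarrow> real) set" where
  "Gamma_set \<rho> f = {\<gamma>. in_space \<rho> \<gamma> \<and> (\<forall>Q. cube_family Q \<longrightarrow> GaRo_ineq f \<gamma> Q)}"

definition GaRo_norm :: "(((real^'n::finite) \<Rightarrow> ennreal) \<Rightarrow> ennreal) \<Rightarrow> ((real^'n) \<Rightarrow> real) \<Rightarrow> real" where
  "GaRo_norm \<rho> f = Inf (space_norm \<rho> ` Gamma_set \<rho> f)"

definition in_GaRo :: "(((real^'n::finite) \<Rightarrow> ennreal) \<Rightarrow> ennreal) \<Rightarrow> ((real^'n) \<Rightarrow> real) \<Rightarrow> bool" where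
  "in_GaRo \<rho> f \<longleftrightarrow> integrable MQ0 f \<and> Gamma_set \<rho> f \<noteq> {}"

end

theory Submission
  imports Defs
begin

text \<open>Let \<open>Q\<close> be a cube of side \<open>h\<close> and let \<open>D\<close> be the fractional derivative of \<open>f\<close>. Since \<open>|x - y|\<close> is at most
  \<open>n h\<close> on \<open>Q\<close>, the mean of \<open>|f x - f y|\<close> over \<open>x \<in> Q\<close> is at most a constant times \<open>h^\<alpha> D y\<close>; averaging over
  \<open>Q\<close> bounds the double integral by \<open>h^\<alpha>\<close> times the integral of \<open>D\<close> over \<open>Q\<close>. The same distance bound gives
  \<open>|z - y|^(\<alpha> - n) \<ge> (n h)^(\<alpha> - n)\<close> on \<open>Q\<close>, so the integral of the Riesz potential of \<open>D\<close> over \<open>Q\<close> is at least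
  a constant times that same quantity. The defining inequality therefore holds cube by cube.\<close>

section \<open>Size and measure of cubes inside \<open>Q0\<close>\<close>

lemma Q0_lmeasurable [simp]: "(Q0::(real^'n::finite) set) \<in> lmeasurable"
  unfolding Q0_def by (rule lmeasurable_box)

lemma Q0_sets_lebesgue [simp, measurable]: "(Q0::(real^'n::finite) set) \<in> sets lebesgue"
  by (simp add: fmeasurableD)

lemma measure_box_cube:
  fixes a :: "real^'n::finite"
  assumes "0 \<le> h"
  shows "measure lebesgue (box a (a + h *\<^sub>R One)) = h ^ CARD('n)"
proof -
  have "measure lebesgue (box a (a + h *\<^sub>R One)) = (\<Prod>b\<in>(Basis::(real^'n) set). h)"
    using assms by (simp add: measure_lborel_box_eq inner_simps)
  then show ?thesis by simp
qed

text \<open>The Euclidean norm is at most the sum of the coordinates. The sharp factor would be the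
  square root of the dimension; the cruder one only affects constants.\<close>

lemma dist_le_in_box_cube:
  fixes a :: "real^'n::finite"
  assumes "x \<in> box a (a + h *\<^sub>R One)" "y \<in> box a (a + h *\<^sub>R One)"
  shows "dist x y \<le> real CARD('n) * h"
proof -
  have "dist x y \<le> (\<Sum>b\<in>Basis. \<bar>(x - y) \<bullet> b\<bar>)"
    unfolding dist_norm by (rule norm_le_l1)
  also have "\<dots> \<le> (\<Sum>b\<in>(Basis::(real^'n) set). h)"
  proof (rule sum_mono)
    fix b :: "real^'n" assume b: "b \<in> Basis"
    then have "a \<bullet> b < x \<bullet> b" "x \<bullet> b < a \<bullet> b + h" "a \<bullet> b < y \<bullet> b" "y \<bullet> b < a \<bullet> b + h"
      using assms by (auto simp: mem_box inner_simps)
    then show "\<bar>(x - y) \<bullet> b\<bar> \<le> h" by (simp add: inner_simps)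
  qed
  finally show ?thesis by simp
qed

lemma Q0_box: "(Q0 :: (real^'n::finite) set) = box 0 (0 + 1 *\<^sub>R One)"
  by (simp add: Q0_def)

lemma dist_le_Q0:
  fixes x y :: "real^'n::finite"
  assumes "x \<in> Q0" "y \<in> Q0"
  shows "dist x y \<le> real CARD('n)"
  using dist_le_in_box_cube[of x 0 1 y] assms unfolding Q0_box by simp

lemma subcube_measurable: "subcube Q \<Longrightarrow> Q \<in> sets lebesgue"
  unfolding subcube_def using lmeasurable_box fmeasurableD by blast

lemma subset_Q0_sets:
  fixes Q :: "(real^'n::finite) set"
  assumes "Q \<in> sets lebesgue" "Q \<subseteq> Q0"
  shows "Q \<in> sets MQ0"
  using assms by (simp add: sets_restrict_space_iff)

lemma set_nn_integral_lebesgue_on: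
  assumes "Q \<subseteq> S" "S \<in> sets lebesgue"
  shows "set_nn_integral (lebesgue_on S) Q f = set_nn_integral lebesgue Q f"
  using assms
  by (subst nn_integral_restrict_space) (auto intro!: nn_integral_cong split: split_indicator)

lemma finite_measure_MQ0: "finite_measure (MQ0 :: (real^'n::finite) measure)"
  by (rule finite_measure_lebesgue_on) simp

lemma borel_measurable_MQ0: "f \<in> borel_measurable borel \<Longrightarrow> f \<in> borel_measurable MQ0"
  by (intro measurable_restrict_space1 measurable_completion) simp

lemma emeasure_MQ0_box_cube:
  fixes a :: "real^'n::finite"
  assumes "0 \<le> h" "box a (a + h *\<^sub>R One) \<subseteq> Q0"
  shows "emeasure MQ0 (box a (a + h *\<^sub>R One)) = ennreal (h ^ CARD('n))"
proof -
  have "emeasure MQ0 (box a (a + h *\<^sub>R One)) = emeasure lebesgue (box a (a + h *\<^sub>R One))"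
    using assms(2) by (intro emeasure_restrict_space) auto
  also have "\<dots> = ennreal (measure lebesgue (box a (a + h *\<^sub>R One)))"
    using lmeasurable_box by (rule emeasure_eq_measure2)
  finally show ?thesis by (simp only: measure_box_cube[OF assms(1)])
qed

lemma emeasure_MQ0: "emeasure MQ0 (Q0 :: (real^'n::finite) set) = 1"
  using emeasure_MQ0_box_cube[of 1 "0::real^'n"] unfolding Q0_box[symmetric] by simp

section \<open>Pointwise control of the oscillation by the fractional derivative\<close>

text \<open>Either \<open>t\<close> is at most \<delta>, or \<open>t / \<delta>\<close> exceeds
  \<open>1\<close> and multiplying \<open>t\<close> by its power \<open>p - 1\<close> only enlarges
  it. Applied to \<open>t = \<bar>f y - f x\<bar>\<close>, this splits the oscillation into a
  constant and a \<open>p\<close>-th power.\<close>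

lemma le_add_powr_mult:
  fixes t \<delta> p :: real
  assumes "0 \<le> t" "0 < \<delta>" "1 < p"
  shows "t \<le> \<delta> + t powr p * \<delta> powr (1 - p)"
proof (cases "t \<le> \<delta>")
  case True
  then show ?thesis by (simp add: add_increasing2)
next
  case False
  then have "t * 1 \<le> t * (t / \<delta>) powr (p - 1)"
    using assms by (intro mult_left_mono ge_one_powr_ge_zero) auto
  also have "\<dots> = t powr p * \<delta> powr (1 - p)"
    using assms False by (simp add: powr_divide powr_diff field_simps)
  finally show ?thesis using assms by simp
qed

text \<open>\<open>f\<close> is only Lebesgue measurable, so joint measurability comes from
  composing \<open>f\<close> and the identity with the two projections. Integrating out one variable
  in \<open>D_frac\<close> relies on it.\<close>

lemma frac_kernel_measurable:
  fixes f :: "real^'n::finite \<Rightarrow> real"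
  assumes [measurable]: "f \<in> borel_measurable MQ0"
  shows "(\<lambda>(x, y). ennreal (\<bar>f x - f y\<bar> powr p / dist x y powr s)) \<in> borel_measurable (MQ0 \<Otimes>\<^sub>M MQ0)"
proof -
  have [measurable]: "(\<lambda>x. x) \<in> borel_measurable (MQ0 :: (real^'n) measure)"
    by (rule borel_measurable_MQ0) simp
  note [measurable] = measurable_compose[OF measurable_fst \<open>(\<lambda>x. x) \<in> borel_measurable (MQ0 :: (real^'n) measure)\<close>]
    measurable_compose[OF measurable_snd \<open>(\<lambda>x. x) \<in> borel_measurable (MQ0 :: (real^'n) measure)\<close>]
  have [measurable]: "(\<lambda>z. f (fst z)) \<in> borel_measurable (MQ0 \<Otimes>\<^sub>M (MQ0 :: (real^'n) measure))"
    "(\<lambda>z. f (snd z)) \<in> borel_measurable ((MQ0 :: (real^'n) measure) \<Otimes>\<^sub>M MQ0)"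
    using measurable_compose[OF measurable_fst assms]
      measurable_compose[OF measurable_snd assms] by simp_all
  show ?thesis
    unfolding case_prod_beta by measurable
qed

lemma enn_powr_measurable [measurable (raw)]:
  assumes [measurable]: "f \<in> borel_measurable M"
  shows "(\<lambda>x. enn_powr (f x) r) \<in> borel_measurable M"
  unfolding enn_powr_def by measurable

lemma D_frac_measurable:
  fixes f :: "real^'n::finite \<Rightarrow> real"
  assumes f: "f \<in> borel_measurable MQ0"
  shows "D_frac p \<alpha> f \<in> borel_measurable MQ0"
proof -
  interpret finite_measure "MQ0 :: (real^'n) measure" by (rule finite_measure_MQ0)
  \<comment> \<open>The integration variable is put second, as \<open>frac_kernel_measurable\<close>
    has it; symmetry of the difference and of the distance leads back to
    \<open>D_frac\<close>.\<close>
  have "(\<lambda>y. \<integral>\<^sup>+x. ennreal (\<bar>f y - f x\<bar> powr p / dist y x powr (real CARD('n) + \<alpha> * p)) \<partial>MQ0)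
      \<in> borel_measurable MQ0"
    by (rule borel_measurable_nn_integral[OF frac_kernel_measurable[OF f]])
  then have "(\<lambda>y. enn_powr (\<integral>\<^sup>+x. ennreal (\<bar>f y - f x\<bar> powr p / dist y x powr (real CARD('n) + \<alpha> * p)) \<partial>MQ0) (1/p))
      \<in> borel_measurable MQ0"
    by measurable
  then show ?thesis
    by (simp add: D_frac_def[abs_def] nn_integral_restrict_space abs_minus_commute dist_commute)
qed

text \<open>The free parameter \<open>\<delta>\<close> replaces Hoelder's inequality: it is chosen below as \<open>h powr \<alpha>\<close> times the
  value of \<open>D_frac\<close> at \<open>y\<close>.\<close>

lemma osc_le_Young:
  fixes f :: "real^'n::finite \<Rightarrow> real"
  assumes f [measurable]: "f \<in> borel_measurable MQ0" and p: "1 < p" and \<alpha>: "0 < \<alpha>"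
    and h: "0 < h" and Q: "Q = box a (a + h *\<^sub>R One)" "Q \<subseteq> Q0" and y: "y \<in> Q" and \<delta>: "0 < \<delta>"
  shows "set_nn_integral lebesgue Q (\<lambda>x. ennreal \<bar>f y - f x\<bar>)
    \<le> ennreal (\<delta> * h ^ CARD('n)) + ennreal (\<delta> powr (1 - p) * (real CARD('n) * h) powr (real CARD('n) + \<alpha> * p)) *
       set_nn_integral lebesgue Q0 (\<lambda>x. ennreal (\<bar>f x - f y\<bar> powr p / dist x y powr (real CARD('n) + \<alpha> * p)))"
proof -
  define s where "s = real CARD('n) + \<alpha> * p"
  define k where "k = (\<lambda>x. ennreal (\<bar>f x - f y\<bar> powr p / dist x y powr s))"
  define c where "c = \<delta> powr (1 - p) * (real CARD('n) * h) powr s"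
  have s: "0 < s" unfolding s_def using p \<alpha> by (simp add: add_pos_pos)
  have c: "0 \<le> c" unfolding c_def by simp
  have Qm: "Q \<in> sets lebesgue" using Q(1) by simp
  have [measurable]: "Q \<in> sets MQ0" using subset_Q0_sets[OF Qm Q(2)] .
  have yQ: "y \<in> Q0" using y Q by auto
  have [measurable]: "k \<in> borel_measurable MQ0"
  proof -
    have "(\<lambda>x. dist x y powr s) \<in> borel_measurable MQ0"
      by (rule borel_measurable_MQ0) measurable
    then show ?thesis unfolding k_def by measurable
  qed
  \<comment> \<open>On the diagonal the left side is \<open>0\<close>. Off it the distance is
    positive, so its power in the denominator can be traded for the largest value
    \<open>(real CARD('n) * h) powr s\<close>.\<close>
  have pt: "ennreal \<bar>f y - f x\<bar> \<le> ennreal \<delta> + ennreal c * k x" if x: "x \<in> Q" for x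
  proof (cases "x = y")
    case False
    let ?t = "\<bar>f y - f x\<bar>"
    have d: "0 < dist x y" "dist x y \<le> real CARD('n) * h"
      using False dist_le_in_box_cube x y Q by auto
    have "?t \<le> \<delta> + ?t powr p * \<delta> powr (1 - p)"
      using le_add_powr_mult[OF _ \<delta> p, of ?t] by simp
    also have "?t powr p \<le> (real CARD('n) * h) powr s * (?t powr p / dist x y powr s)"
    proof -
      have "dist x y powr s \<le> (real CARD('n) * h) powr s"
        using d s by (intro powr_mono2) auto
      then have "?t powr p * dist x y powr s \<le> ?t powr p * (real CARD('n) * h) powr s"
        by (intro mult_left_mono) auto
      then show ?thesis using d by (simp add: field_simps)
    qed
    finally have "?t \<le> \<delta> + c * (?t powr p / dist x y powr s)"
      using \<delta> unfolding c_def by (simp add: mult_ac mult_right_mono)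
    then have "ennreal ?t \<le> ennreal (\<delta> + c * (?t powr p / dist x y powr s))"
      by (rule ennreal_leI)
    also have "\<dots> = ennreal \<delta> + ennreal c * k x"
      unfolding k_def using \<delta> c
      by (subst ennreal_plus, simp, simp, subst ennreal_mult) (auto simp: abs_minus_commute)
    finally show ?thesis .
  qed simp
  have "set_nn_integral lebesgue Q (\<lambda>x. ennreal \<bar>f y - f x\<bar>) = set_nn_integral MQ0 Q (\<lambda>x. ennreal \<bar>f y - f x\<bar>)"
    by (rule set_nn_integral_lebesgue_on[symmetric]) (use Q in auto)
  \<comment> \<open>The indicator stays on the constant, which yields the measure of
    \<open>Q\<close>, and is dropped from \<open>k\<close>, which yields the full integral over
    \<open>Q0\<close> that occurs in \<open>D_frac\<close>.\<close>
  also have "\<dots> \<le> (\<integral>\<^sup>+x. ennreal \<delta> * indicator Q x + ennreal c * k x \<partial>MQ0)"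
    by (rule nn_integral_mono) (auto split: split_indicator intro: pt)
  also have "\<dots> = ennreal \<delta> * emeasure MQ0 Q + ennreal c * integral\<^sup>N MQ0 k"
    by (subst nn_integral_add) (auto simp: nn_integral_cmult)
  also have "emeasure MQ0 Q = ennreal (h ^ CARD('n))"
    unfolding Q(1) by (rule emeasure_MQ0_box_cube) (use h Q in auto)
  also have "integral\<^sup>N MQ0 k = set_nn_integral lebesgue Q0 k"
    by (simp add: nn_integral_restrict_space)
  finally show ?thesis
    unfolding k_def c_def s_def using \<delta> h by (simp add: ennreal_mult')
qed

text \<open>The choice of \<delta> balances the two terms of \<open>osc_le_Young\<close>: each
  becomes a multiple of \<open>h powr \<alpha> * h ^ CARD('n) * D_frac p \<alpha> f y\<close>. It
  requires a finite positive value of \<open>D_frac\<close>, so the values infinity and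
  \<open>0\<close> are treated separately.\<close>

lemma osc_le_D_frac:
  fixes f :: "real^'n::finite \<Rightarrow> real"
  assumes f: "f \<in> borel_measurable MQ0" and p: "1 < p" and \<alpha>: "0 < \<alpha>"
    and h: "0 < h" and Q: "Q = box a (a + h *\<^sub>R One)" "Q \<subseteq> Q0" and y: "y \<in> Q"
  shows "set_nn_integral lebesgue Q (\<lambda>x. ennreal \<bar>f y - f x\<bar>)
    \<le> ennreal ((1 + real CARD('n) powr (real CARD('n) + \<alpha> * p)) * h powr \<alpha> * h ^ CARD('n)) * D_frac p \<alpha> f y"
proof -
  define s where "s = real CARD('n) + \<alpha> * p"
  define I where "I = set_nn_integral lebesgue Q0 (\<lambda>x. ennreal (\<bar>f x - f y\<bar> powr p / dist x y powr s))"
  define L where "L = set_nn_integral lebesgue Q (\<lambda>x. ennreal \<bar>f y - f x\<bar>)"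
  define N where "N = real CARD('n)"
  have N: "N \<ge> 1" unfolding N_def by simp
  have D: "D_frac p \<alpha> f y = enn_powr I (1 / p)" unfolding D_frac_def I_def s_def ..
  have Young: "L \<le> ennreal (\<delta> * h ^ CARD('n)) + ennreal (\<delta> powr (1 - p) * (N * h) powr s) * I"
    if "0 < \<delta>" for \<delta>
    unfolding L_def I_def s_def N_def by (rule osc_le_Young[OF f p \<alpha> h Q y that])
  have c: "0 < (1 + N powr s) * h powr \<alpha> * h ^ CARD('n)"
    using h by (intro mult_pos_pos add_pos_nonneg) auto
  show ?thesis
  proof (cases "I = \<infinity>")
    case True
    \<comment> \<open>The constant must be nonzero for the right side to be infinite, since
      \<open>0 * \<infinity>\<close> is \<open>0\<close> in \<open>ennreal\<close>.\<close>
    have "ennreal ((1 + N powr s) * h powr \<alpha> * h ^ CARD('n)) \<noteq> 0"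
      using c by (simp only: ennreal_eq_0_iff not_le)
    then have "ennreal ((1 + N powr s) * h powr \<alpha> * h ^ CARD('n)) * D_frac p \<alpha> f y = \<infinity>"
      using True by (simp add: D enn_powr_def ennreal_mult_top del: ennreal_eq_0_iff)
    then show ?thesis unfolding s_def N_def by simp
  next
    case False
    then obtain i where i: "I = ennreal i" "0 \<le> i" by (cases I) auto
    have Di: "D_frac p \<alpha> f y = ennreal (i powr (1 / p))" using i by (simp add: D enn_powr_def)
    have Young': "L \<le> ennreal (\<delta> * h ^ CARD('n) + \<delta> powr (1 - p) * (N * h) powr s * i)"
      if "0 < \<delta>" for \<delta>
      using Young[OF that] i that h by (simp add: ennreal_mult')
    show ?thesis
    proof (cases "i = 0")
      case True
      \<comment> \<open>With \<open>i = 0\<close> the second term vanishes for every positive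
        \<delta>. The value \<open>e / h ^ CARD('n)\<close> turns the first term into the arbitrary
        \<open>e\<close>.\<close>
      have "L \<le> 0"
      proof (rule ennreal_le_epsilon)
        fix e :: real assume "0 < e"
        then have "L \<le> ennreal (e / h ^ CARD('n) * h ^ CARD('n))"
          using Young'[of "e / h ^ CARD('n)"] True h by simp
        then show "L \<le> 0 + ennreal e" using h by simp
      qed
      then show ?thesis unfolding L_def by simp
    next
      case False
      with i have ip: "0 < i" by simp
      define d where "d = i powr (1 / p)"
      have d: "0 < d" "i = d powr p" using ip p by (auto simp: d_def powr_powr)
      have pow: "h ^ CARD('n) = h powr N" using h by (simp add: N_def powr_realpow)
      \<comment> \<open>The exponents of \<open>h\<close> add up to
        \<open>\<alpha> * (1 - p) + N + \<alpha> * p = \<alpha> + N\<close>, those of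
        \<open>d\<close> to \<open>1\<close>.\<close>
      have "(h powr \<alpha> * d) powr (1 - p) * (N * h) powr s * i
          = N powr s * (h powr (\<alpha> * (1 - p)) * h powr s) * (d powr (1 - p) * d powr p)"
        using h d N by (simp add: powr_mult powr_powr)
      also have "h powr (\<alpha> * (1 - p)) * h powr s = h powr \<alpha> * h powr N"
        by (simp add: s_def N_def algebra_simps flip: powr_add)
      also have "d powr (1 - p) * d powr p = d" using d by (simp flip: powr_add)
      finally have "L \<le> ennreal (h powr \<alpha> * d * h powr N + N powr s * (h powr \<alpha> * h powr N) * d)"
        using Young'[of "h powr \<alpha> * d"] h d pow by simp
      also have "\<dots> = ennreal ((1 + N powr s) * h powr \<alpha> * h powr N * d)"
        by (simp add: algebra_simps)
      also have "\<dots> = ennreal ((1 + N powr s) * h powr \<alpha> * h powr N) * ennreal d"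
        using d by (intro ennreal_mult) auto
      finally show ?thesis
        unfolding Di L_def pow s_def N_def d_def .
    qed
  qed
qed

section \<open>Uniform integrability of the Riesz kernel over \<open>Q0\<close>\<close>

text \<open>The point \<open>x\<close> lies in a dyadic shell around \<open>y\<close>: the outer
  radius places it in the ball, the inner radius bounds the kernel. The singular kernel is thus
  dominated by a series of constants on balls.\<close>

lemma less_dyadic_ball_kernel:
  fixes x y :: "'a::metric_space"
  assumes "0 < dist x y" "dist x y \<le> r" "0 \<le> s"
  shows "\<exists>k. x \<in> cball y (r * (1/2) ^ k) \<and> 1 / dist x y powr s \<le> (r * (1/2) ^ Suc k) powr - s"
proof -
  have r: "0 < r" using assms by linarith
  have ex: "\<exists>k. r * (1/2) ^ Suc k < dist x y"
  proof -
    obtain k where "(1/2::real) ^ k < dist x y / r"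
      using real_arch_pow_inv[of "dist x y / r" "1/2"] assms r by auto
    then have "r * (1/2) ^ k < dist x y" using r by (simp add: field_simps)
    moreover have "r * (1/2) ^ Suc k \<le> r * (1/2) ^ k" using r by simp
    ultimately show ?thesis by (intro exI[of _ k]) linarith
  qed
  \<comment> \<open>The least index gives both radii: its own property is the inner bound, failure
    at its predecessor the outer one. For index \<open>0\<close> the outer bound is the assumption
    on \<open>r\<close>.\<close>
  define k where "k = (LEAST k. r * (1/2) ^ Suc k < dist x y)"
  have k: "r * (1/2) ^ Suc k < dist x y"
    unfolding k_def by (rule LeastI_ex[OF ex])
  have "dist x y \<le> r * (1/2) ^ k"
  proof (cases k)
    case 0
    then show ?thesis using assms by simp
  next
    case (Suc j)
    then have "\<not> r * (1/2) ^ Suc j < dist x y"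
      using not_less_Least[of j "\<lambda>k. r * (1/2) ^ Suc k < dist x y"] unfolding k_def by simp
    then show ?thesis using Suc by simp
  qed
  moreover have "1 / dist x y powr s \<le> (r * (1/2) ^ Suc k) powr - s"
  proof -
    have "(r * (1/2) ^ Suc k) powr s \<le> dist x y powr s"
    proof (rule powr_mono2)
      show "0 \<le> r * (1/2) ^ Suc k" using r by (intro mult_nonneg_nonneg) auto
    qed (use k assms in auto)
    moreover have "0 < (r * (1/2) ^ Suc k) powr s" using r by simp
    ultimately have "1 / dist x y powr s \<le> 1 / (r * (1/2) ^ Suc k) powr s" by (intro frac_le) auto
    then show ?thesis by (simp only: powr_minus_divide)
  qed
  ultimately show ?thesis by (intro exI[of _ k]) (simp only: mem_cball dist_commute[of y x])
qed

lemma ennreal_le_suminf: "f k \<le> (\<Sum>i. f i :: ennreal)"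
  using sum_le_suminf[of f "{k}"] by simp

text \<open>On the ball of radius \<open>N * (1/2) ^ k\<close> the kernel is replaced by a constant
  comparable to the radius to the power \<open>- s\<close>, while the volume scales with the power
  \<open>N\<close>. The contributions form a geometric series, convergent because
  \<open>s < N\<close>. Ball volumes do not depend on the centre, so \<open>B\<close> serves every
  \<open>y\<close>.\<close>

lemma kernel_integral_bounded:
  fixes s :: real
  assumes s: "0 \<le> s" "s < real CARD('n::finite)"
  obtains B :: ennreal where "B < \<infinity>"
    "\<And>y::real^'n. y \<in> Q0 \<Longrightarrow> (\<integral>\<^sup>+z. ennreal (1 / dist z y powr s) \<partial>MQ0) \<le> B"
proof -
  define N where "N = real CARD('n)"
  have N: "N \<ge> 1" unfolding N_def by simp
  define V where "V = unit_ball_vol N"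
  have V: "0 \<le> V" unfolding V_def N_def by simp
  define c where "c = (\<lambda>k::nat. (N * (1/2) ^ Suc k) powr - s)"
  define q where "q = (1/2::real) powr (N - s)"
  have q: "0 \<le> q" "q < 1"
  proof -
    show "q < 1" unfolding q_def using s powr_less_mono'[of "1/2" 0 "N - s"] by (simp add: N_def)
  qed (simp add: q_def)
  have term_eq: "c k * (V * (N * (1/2) ^ k) ^ CARD('n)) = (N / 2) powr - s * V * N powr N * q ^ k" for k
  proof -
    have "(N * (1/2) ^ k) ^ CARD('n) = (N * (1/2) powr k) powr N"
      using N by (simp add: N_def powr_realpow[symmetric] del: powr_numeral)
    also have "\<dots> = N powr N * (1/2) powr (k * N)"
      using N by (simp add: powr_mult powr_powr)
    finally have 1: "(N * (1/2) ^ k) ^ CARD('n) = N powr N * (1/2) powr (k * N)" .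
    have "c k = (N / 2 * (1/2) powr k) powr - s"
      unfolding c_def by (simp add: powr_realpow)
    also have "\<dots> = (N / 2) powr - s * (1/2) powr (- (k * s))"
      using N by (subst powr_mult) (auto simp: powr_powr)
    finally have 2: "c k = (N / 2) powr - s * (1/2) powr (- (k * s))" .
    have "q ^ k = (1/2) powr (- (k * s)) * (1/2) powr (k * N)"
      unfolding q_def powr_add[symmetric]
      by (simp add: powr_realpow[symmetric] powr_powr algebra_simps)
    with 1 2 show ?thesis by (simp add: mult_ac)
  qed
  define B where "B = (\<Sum>k. ennreal (c k * (V * (N * (1/2) ^ k) ^ CARD('n))))"
  have "summable (\<lambda>k. c k * (V * (N * (1/2) ^ k) ^ CARD('n)))"
    unfolding term_eq using q by (intro summable_mult summable_geometric) simp
  then have "B < \<infinity>"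
    unfolding B_def using V N by (subst suminf_ennreal2) (auto simp: c_def)
  moreover have "(\<integral>\<^sup>+z. ennreal (1 / dist z y powr s) \<partial>MQ0) \<le> B" if y: "y \<in> Q0" for y :: "real^'n"
  proof -
    have "(\<integral>\<^sup>+z. ennreal (1 / dist z y powr s) \<partial>MQ0)
        \<le> (\<integral>\<^sup>+z. (\<Sum>k. ennreal (c k) * indicator (cball y (N * (1/2) ^ k)) z) \<partial>lebesgue)"
    proof (subst nn_integral_restrict_space, simp, rule nn_integral_mono)
      fix z :: "real^'n"
      show "ennreal (1 / dist z y powr s) * indicator Q0 z
          \<le> (\<Sum>k. ennreal (c k) * indicator (cball y (N * (1/2) ^ k)) z)"
      \<comment> \<open>At \<open>z = y\<close> the kernel is \<open>0\<close> by the convention for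
        division by zero, so only the other points of \<open>Q0\<close> need a ball.\<close>
      proof (cases "z \<in> Q0 \<and> z \<noteq> y")
        case True
        then obtain k where k: "z \<in> cball y (N * (1/2) ^ k)"
            "1 / dist z y powr s \<le> c k"
          using less_dyadic_ball_kernel[of z y N s] dist_le_Q0[of z y] y s
          unfolding N_def c_def by auto
        have "ennreal (1 / dist z y powr s) * indicator Q0 z \<le> ennreal (c k) * indicator (cball y (N * (1/2) ^ k)) z"
          using k True by (simp add: ennreal_leI)
        also have "\<dots> \<le> (\<Sum>k. ennreal (c k) * indicator (cball y (N * (1/2) ^ k)) z)"
          by (rule ennreal_le_suminf)
        finally show ?thesis .
      qed auto
    qed
    also have "\<dots> = (\<Sum>k. ennreal (c k) * emeasure lebesgue (cball y (N * (1/2) ^ k)))"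
      by (subst nn_integral_suminf)
        (auto simp: nn_integral_cmult_indicator intro!: borel_measurable_times_ennreal borel_measurable_indicator)
    also have "\<dots> = B"
    proof -
      have "ennreal (c k) * emeasure lebesgue (cball y (N * (1/2) ^ k))
          = ennreal (c k * (V * (N * (1/2) ^ k) ^ CARD('n)))" for k
      proof -
        have "emeasure lebesgue (cball y (N * (1/2) ^ k)) = ennreal (V * (N * (1/2) ^ k) ^ CARD('n))"
          using emeasure_cball[of "N * (1/2) ^ k" y] N by (simp add: V_def N_def)
        then show ?thesis by (simp add: ennreal_mult' c_def)
      qed
      then show ?thesis unfolding B_def by simp
    qed
    finally show ?thesis .
  qed
  ultimately show ?thesis by (rule that)
qed

section \<open>The Riesz potential of a nonnegative integrable function\<close>

lemma riesz_nonneg: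
  assumes "\<And>y. 0 \<le> g y"
  shows "0 \<le> riesz \<alpha> g z"
  unfolding riesz_def set_lebesgue_integral_def
  by (intro Bochner_Integration.integral_nonneg) (auto simp: assms)

lemma riesz_kernel_measurable:
  fixes g :: "real^'n::finite \<Rightarrow> real"
  assumes g: "g \<in> borel_measurable MQ0"
  shows "(\<lambda>(z, y). ennreal (g y / dist z y powr s)) \<in> borel_measurable (MQ0 \<Otimes>\<^sub>M MQ0)"
proof -
  have id: "(\<lambda>x. x) \<in> borel_measurable (MQ0 :: (real^'n) measure)"
    by (rule borel_measurable_MQ0) simp
  note [measurable] = measurable_compose[OF measurable_fst id] measurable_compose[OF measurable_snd id]
    measurable_compose[OF measurable_snd g]
  show ?thesis unfolding case_prod_beta by measurable
qed

text \<open>\<open>riesz\<close> is a Bochner integral, hence \<open>0\<close> wherever the defining integral diverges; local integrability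
  of the kernel confines this to a null set.\<close>

lemma riesz_eq_nn_integral:
  fixes g :: "real^'n::finite \<Rightarrow> real"
  assumes \<alpha>: "0 < \<alpha>" "\<alpha> < 1" and g: "g \<in> borel_measurable MQ0" and g0: "\<And>y. 0 \<le> g y"
    and fin: "(\<integral>\<^sup>+y. ennreal (g y) \<partial>MQ0) < \<infinity>"
  defines "R \<equiv> \<lambda>z. \<integral>\<^sup>+y. ennreal (g y / dist z y powr (real CARD('n) - \<alpha>)) \<partial>MQ0"
  shows "R \<in> borel_measurable MQ0"
    and "AE z in MQ0. ennreal (riesz \<alpha> g z) = R z"
    and "(\<integral>\<^sup>+z. R z \<partial>MQ0) < \<infinity>"
proof -
  interpret M: finite_measure "MQ0 :: (real^'n) measure" by (rule finite_measure_MQ0)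
  interpret P: pair_sigma_finite "MQ0 :: (real^'n) measure" "MQ0 :: (real^'n) measure" ..
  define s where "s = real CARD('n) - \<alpha>"
  have "1 \<le> real CARD('n)" by simp
  then have s: "0 \<le> s" "s < real CARD('n)" using \<alpha> unfolding s_def by linarith+
  note meas = riesz_kernel_measurable[OF g, of s]
  show Rm: "R \<in> borel_measurable MQ0"
    unfolding R_def using M.borel_measurable_nn_integral[OF meas] by (simp add: s_def)
  obtain B where B: "B < \<infinity>"
      "\<And>y::real^'n. y \<in> Q0 \<Longrightarrow> (\<integral>\<^sup>+z. ennreal (1 / dist z y powr s) \<partial>MQ0) \<le> B"
    using kernel_integral_bounded[OF s] by blast
  have km: "(\<lambda>z. ennreal (1 / dist z y powr s)) \<in> borel_measurable MQ0" for y :: "real^'n"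
    by (rule borel_measurable_MQ0) measurable
  \<comment> \<open>Exchanging the integrals isolates the kernel, whose integral in \<open>z\<close>
    is at most \<open>B\<close> uniformly in \<open>y\<close>; hence \<open>R\<close> is integrable
    and finite almost everywhere.\<close>
  have "(\<integral>\<^sup>+z. R z \<partial>MQ0) = (\<integral>\<^sup>+y. (\<integral>\<^sup>+z. ennreal (g y / dist z y powr s) \<partial>MQ0) \<partial>MQ0)"
    unfolding R_def s_def[symmetric] by (rule P.Fubini'[OF meas, symmetric])
  also have "\<dots> = (\<integral>\<^sup>+y. ennreal (g y) * (\<integral>\<^sup>+z. ennreal (1 / dist z y powr s) \<partial>MQ0) \<partial>MQ0)"
    by (intro nn_integral_cong, subst nn_integral_cmult[symmetric])
       (auto simp: km g0 ennreal_mult[symmetric] intro!: nn_integral_cong)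
  also have "\<dots> \<le> (\<integral>\<^sup>+y. ennreal (g y) * B \<partial>MQ0)"
    by (intro nn_integral_mono mult_left_mono B) auto
  also have "\<dots> = (\<integral>\<^sup>+y. ennreal (g y) \<partial>MQ0) * B"
    using g by (intro nn_integral_multc) measurable
  also have "\<dots> < \<infinity>" using fin B by (simp add: ennreal_mult_less_top)
  finally show Rfin: "(\<integral>\<^sup>+z. R z \<partial>MQ0) < \<infinity>" .
  have "AE z in MQ0. R z \<noteq> \<infinity>"
    using nn_integral_noteq_infinite[OF Rm] Rfin by simp
  \<comment> \<open>\<open>enn2real\<close> sends infinity to \<open>0\<close>, just as the Bochner
    integral does, so this identity holds at every \<open>z\<close>.\<close>
  moreover have "riesz \<alpha> g z = enn2real (R z)" for z
  proof -
    have gm: "(\<lambda>y. g y / dist z y powr s) \<in> borel_measurable MQ0"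
    proof -
      have [measurable]: "(\<lambda>y. dist z y powr s) \<in> borel_measurable MQ0"
        by (rule borel_measurable_MQ0) measurable
      show ?thesis using g by measurable
    qed
    have "riesz \<alpha> g z = integral\<^sup>L MQ0 (\<lambda>y. g y / dist z y powr s)"
      unfolding riesz_def set_lebesgue_integral_def s_def
      by (simp add: integral_restrict_space)
    also have "\<dots> = enn2real (R z)"
      unfolding R_def s_def[symmetric] by (rule integral_eq_nn_integral[OF gm]) (simp add: g0)
    finally show ?thesis .
  qed
  ultimately show "AE z in MQ0. ennreal (riesz \<alpha> g z) = R z"
    by (auto simp: less_top)
qed

text \<open>Mass of \<open>g\<close> outside the cube is discarded by nonnegativity. Inside, the
  kernel is at least its value at the distance bound, which gives a lower bound constant in
  \<open>z\<close>; integrating over \<open>z\<close> contributes the factor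
  \<open>h ^ CARD('n)\<close>.\<close>

lemma nn_integral_riesz_ge:
  fixes g :: "real^'n::finite \<Rightarrow> real"
  assumes \<alpha>: "0 < \<alpha>" "\<alpha> < 1" and g: "g \<in> borel_measurable MQ0" and g0: "\<And>y. 0 \<le> g y"
    and fin: "(\<integral>\<^sup>+y. ennreal (g y) \<partial>MQ0) < \<infinity>"
    and h: "0 < h" and Q: "Q = box a (a + h *\<^sub>R One)" "Q \<subseteq> Q0"
  shows "ennreal ((real CARD('n) * h) powr (\<alpha> - real CARD('n)) * h ^ CARD('n)) *
      set_nn_integral MQ0 Q (\<lambda>y. ennreal (g y))
    \<le> set_nn_integral MQ0 Q (\<lambda>z. ennreal (riesz \<alpha> g z))"
proof -
  define R where "R = (\<lambda>z. \<integral>\<^sup>+y. ennreal (g y / dist z y powr (real CARD('n) - \<alpha>)) \<partial>MQ0)"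
  define c where "c = (real CARD('n) * h) powr (\<alpha> - real CARD('n))"
  define G where "G = set_nn_integral MQ0 Q (\<lambda>y. ennreal (g y))"
  have Qm: "Q \<in> sets lebesgue" using Q(1) by simp
  have Qs [measurable]: "Q \<in> sets MQ0" using subset_Q0_sets[OF Qm Q(2)] .
  have "1 \<le> real CARD('n)" by simp
  then have na: "\<alpha> < real CARD('n)" using \<alpha> by linarith
  have eQ: "emeasure MQ0 Q = ennreal (h ^ CARD('n))"
    unfolding Q(1) by (rule emeasure_MQ0_box_cube) (use h Q in auto)
  have ge: "ennreal c * G \<le> R z" if z: "z \<in> Q" for z
  proof -
    have "ennreal c * G = (\<integral>\<^sup>+y. ennreal c * (ennreal (g y) * indicator Q y) \<partial>MQ0)"
      unfolding G_def using g
      by (intro nn_integral_cmult[symmetric] borel_measurable_times_ennreal borel_measurable_indicator Qs) measurable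
    also have "\<dots> \<le> R z"
      unfolding R_def
    proof (rule nn_integral_mono_AE)
      \<comment> \<open>The point \<open>y = z\<close> has to be removed: the quotient is
        \<open>0\<close> there by convention, and the lower bound can fail.\<close>
      have "AE y in lebesgue. y \<noteq> z"
        by (intro AE_completion AE_lborel_singleton)
      then have "AE y in MQ0. y \<noteq> z"
        by (subst AE_restrict_space_iff) auto
      then show "AE y in MQ0. ennreal c * (ennreal (g y) * indicator Q y)
          \<le> ennreal (g y / dist z y powr (real CARD('n) - \<alpha>))"
      proof eventually_elim
        case (elim y)
        show ?case
        proof (cases "y \<in> Q")
          case True
          have "dist z y powr (real CARD('n) - \<alpha>) \<le> (real CARD('n) * h) powr (real CARD('n) - \<alpha>)"
            using dist_le_in_box_cube[of z a h y] z True Q na by (intro powr_mono2) auto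
          moreover have "0 < dist z y powr (real CARD('n) - \<alpha>)" using elim by simp
          ultimately have "1 / (real CARD('n) * h) powr (real CARD('n) - \<alpha>) \<le> 1 / dist z y powr (real CARD('n) - \<alpha>)"
            by (intro frac_le) auto
          moreover have "c = 1 / (real CARD('n) * h) powr (real CARD('n) - \<alpha>)"
            unfolding c_def by (simp flip: powr_minus_divide)
          ultimately have "c * g y \<le> 1 / dist z y powr (real CARD('n) - \<alpha>) * g y"
            using g0 by (intro mult_right_mono) auto
          then have "ennreal (c * g y) \<le> ennreal (g y / dist z y powr (real CARD('n) - \<alpha>))"
            by (intro ennreal_leI) simp
          then show ?thesis using True g0 by (simp add: ennreal_mult c_def)
        qed simp
      qed
    qed
    finally show ?thesis .
  qed
  have "ennreal (c * h ^ CARD('n)) * G = (ennreal c * G) * emeasure MQ0 Q"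
    using h by (simp add: eQ ennreal_mult c_def mult_ac)
  also have "\<dots> = (\<integral>\<^sup>+z. ennreal c * G * indicator Q z \<partial>MQ0)"
    by (simp add: nn_integral_cmult_indicator)
  also have "\<dots> \<le> set_nn_integral MQ0 Q R"
    by (intro nn_integral_mono) (auto split: split_indicator intro: ge)
  also have "\<dots> = set_nn_integral MQ0 Q (\<lambda>z. ennreal (riesz \<alpha> g z))"
    using riesz_eq_nn_integral(2)[OF \<alpha> g g0 fin] unfolding R_def
    by (intro nn_integral_cong_AE) auto
  finally show ?thesis unfolding c_def G_def .
qed

section \<open>From single cubes to countable families\<close>

text \<open>The cube estimates are summed. Integrability of \<gamma> over \<open>Q0\<close> is what
  makes the right side of \<open>GaRo_ineq\<close>, a real series of Bochner integrals, coincide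
  with the corresponding sum of nonnegative integrals.\<close>

lemma GaRo_ineqI:
  fixes f \<gamma> :: "real^'n::finite \<Rightarrow> real"
  assumes \<gamma>: "\<gamma> \<in> borel_measurable MQ0" "\<And>z. 0 \<le> \<gamma> z" "(\<integral>\<^sup>+z. ennreal (\<gamma> z) \<partial>MQ0) < \<infinity>"
    and Q: "cube_family Q"
    and cube: "\<And>S. subcube S \<Longrightarrow> ennreal (1 / measure lebesgue S) *
        set_nn_integral lebesgue S (\<lambda>x. set_nn_integral lebesgue S (\<lambda>y. ennreal \<bar>f x - f y\<bar>))
        \<le> set_nn_integral MQ0 S (\<lambda>z. ennreal (\<gamma> z))"
  shows "GaRo_ineq f \<gamma> Q"
proof -
  define a where "a = (\<lambda>i. set_lebesgue_integral lebesgue (Q i) \<gamma>)"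
  have Qs: "Q i \<in> sets lebesgue" "Q i \<subseteq> Q0" for i
    using Q subcube_measurable[of "Q i"] unfolding cube_family_def subcube_def by fastforce+
  have [measurable]: "Q i \<in> sets MQ0" for i using subset_Q0_sets[OF Qs] .
  have a0: "0 \<le> a i" for i
    unfolding a_def set_lebesgue_integral_def
    by (intro Bochner_Integration.integral_nonneg) (auto simp: \<gamma>)
  have a_eq: "ennreal (a i) = set_nn_integral MQ0 (Q i) (\<lambda>z. ennreal (\<gamma> z))" for i
  proof -
    have "(\<lambda>z. indicator (Q i) z * \<gamma> z) \<in> borel_measurable MQ0" using \<gamma>(1) by measurable
    then have m: "(\<lambda>z. indicat_real Q0 z *\<^sub>R (indicator (Q i) z * \<gamma> z)) \<in> borel_measurable lebesgue"
      by (subst (asm) borel_measurable_restrict_space_iff) auto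
    have eq: "(\<lambda>z. indicat_real Q0 z *\<^sub>R (indicator (Q i) z * \<gamma> z)) = (\<lambda>z. indicator (Q i) z *\<^sub>R \<gamma> z)"
      by (rule ext) (use Qs(2)[of i] in \<open>auto simp: indicator_def\<close>)
    have nn: "set_nn_integral MQ0 (Q i) (\<lambda>z. ennreal (\<gamma> z)) = (\<integral>\<^sup>+z. ennreal (indicator (Q i) z *\<^sub>R \<gamma> z) \<partial>lebesgue)"
      unfolding set_nn_integral_lebesgue_on[OF Qs(2) Q0_sets_lebesgue]
      by (intro nn_integral_cong) (auto split: split_indicator)
    have "set_nn_integral MQ0 (Q i) (\<lambda>z. ennreal (\<gamma> z)) \<le> (\<integral>\<^sup>+z. ennreal (\<gamma> z) \<partial>MQ0)"
      by (intro nn_integral_mono) (auto split: split_indicator)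
    also have "\<dots> < \<infinity>" by (rule \<gamma>)
    finally have "set_nn_integral MQ0 (Q i) (\<lambda>z. ennreal (\<gamma> z)) < top" by simp
    moreover have "a i = enn2real (set_nn_integral MQ0 (Q i) (\<lambda>z. ennreal (\<gamma> z)))"
      unfolding a_def set_lebesgue_integral_def nn
      by (rule integral_eq_nn_integral) (use m[unfolded eq] \<gamma>(2) in auto)
    ultimately show ?thesis by simp
  qed
  \<comment> \<open>Disjointness bounds the series by the integral of \<gamma> over
    \<open>Q0\<close>. Without summability the real series would not be the value of this
    sum.\<close>
  have fin: "(\<Sum>i. ennreal (a i)) \<noteq> top"
  proof -
    have "(\<Sum>i. ennreal (a i)) = set_nn_integral MQ0 (\<Union>i. Q i) (\<lambda>z. ennreal (\<gamma> z))"
      unfolding a_eq using Q \<gamma>(1)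
      by (intro nn_integral_disjoint_family[symmetric]) (auto simp: cube_family_def)
    also have "\<dots> \<le> (\<integral>\<^sup>+z. ennreal (\<gamma> z) \<partial>MQ0)"
      by (intro nn_integral_mono) (auto split: split_indicator)
    also have "\<dots> < top" using \<gamma>(3) by simp
    finally show ?thesis by simp
  qed
  have sm: "summable a" by (rule summable_suminf_not_top[OF a0 fin])
  have "(\<Sum>i. ennreal (1 / measure lebesgue (Q i)) *
        set_nn_integral lebesgue (Q i) (\<lambda>x. set_nn_integral lebesgue (Q i) (\<lambda>y. ennreal \<bar>f x - f y\<bar>)))
      \<le> (\<Sum>i. ennreal (a i))"
  proof (rule suminf_le)
    fix i
    show "ennreal (1 / measure lebesgue (Q i)) *
        set_nn_integral lebesgue (Q i) (\<lambda>x. set_nn_integral lebesgue (Q i) (\<lambda>y. ennreal \<bar>f x - f y\<bar>))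
      \<le> ennreal (a i)"
    proof (cases "Q i = {}")
      case False
      then have "subcube (Q i)" using Q by (auto simp: cube_family_def)
      then show ?thesis unfolding a_eq by (rule cube)
    qed simp
  qed auto
  also have "\<dots> = ennreal (suminf a)" by (rule suminf_ennreal2[OF a0 sm])
  finally show ?thesis
    unfolding GaRo_ineq_def less_eq_ennreal.rep_eq enn2ereal_ennreal[OF suminf_nonneg[OF sm a0]]
    by (simp only: a_def)
qed

section \<open>Averaged oscillation on a cube and integrability of \<open>f\<close>\<close>

text \<open>\<open>osc_le_D_frac\<close> is integrated over the outer variable, at which
  \<open>D_frac\<close> is evaluated. Its factor \<open>h ^ CARD('n)\<close> cancels against the
  measure of the cube, leaving \<open>h powr \<alpha>\<close>.\<close>

lemma double_osc_le_D_frac: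
  fixes f :: "real^'n::finite \<Rightarrow> real"
  assumes f: "f \<in> borel_measurable MQ0" and p: "1 < p" and \<alpha>: "0 < \<alpha>"
    and h: "0 < h" and Q: "Q = box a (a + h *\<^sub>R One)" "Q \<subseteq> Q0"
  shows "ennreal (1 / measure lebesgue Q) *
      set_nn_integral lebesgue Q (\<lambda>x. set_nn_integral lebesgue Q (\<lambda>y. ennreal \<bar>f x - f y\<bar>))
    \<le> ennreal ((1 + real CARD('n) powr (real CARD('n) + \<alpha> * p)) * h powr \<alpha>) * set_nn_integral MQ0 Q (D_frac p \<alpha> f)"
proof -
  define c where "c = (1 + real CARD('n) powr (real CARD('n) + \<alpha> * p)) * h powr \<alpha>"
  have c: "0 \<le> c" unfolding c_def by simp
  have mQ: "measure lebesgue Q = h ^ CARD('n)" unfolding Q(1) using h by (intro measure_box_cube) simp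
  have Qs: "Q \<in> sets MQ0" using Q by (intro subset_Q0_sets) auto
  have "set_nn_integral lebesgue Q (\<lambda>x. set_nn_integral lebesgue Q (\<lambda>y. ennreal \<bar>f x - f y\<bar>))
      = set_nn_integral MQ0 Q (\<lambda>x. set_nn_integral lebesgue Q (\<lambda>y. ennreal \<bar>f x - f y\<bar>))"
    using Q by (intro set_nn_integral_lebesgue_on[symmetric]) auto
  also have "\<dots> \<le> (\<integral>\<^sup>+x. ennreal (c * h ^ CARD('n)) * (D_frac p \<alpha> f x * indicator Q x) \<partial>MQ0)"
  proof (rule nn_integral_mono)
    fix x
    show "set_nn_integral lebesgue Q (\<lambda>y. ennreal \<bar>f x - f y\<bar>) * indicator Q x
        \<le> ennreal (c * h ^ CARD('n)) * (D_frac p \<alpha> f x * indicator Q x)"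
      using osc_le_D_frac[OF f p \<alpha> h Q, of x]
      by (cases "x \<in> Q") (simp_all add: c_def)
  qed
  also have "\<dots> = ennreal (c * h ^ CARD('n)) * set_nn_integral MQ0 Q (D_frac p \<alpha> f)"
    using D_frac_measurable[OF f] Qs
    by (intro nn_integral_cmult borel_measurable_times_ennreal borel_measurable_indicator) auto
  finally have "ennreal (1 / measure lebesgue Q) *
      set_nn_integral lebesgue Q (\<lambda>x. set_nn_integral lebesgue Q (\<lambda>y. ennreal \<bar>f x - f y\<bar>))
    \<le> ennreal (1 / h ^ CARD('n)) * (ennreal (c * h ^ CARD('n)) * set_nn_integral MQ0 Q (D_frac p \<alpha> f))"
    unfolding mQ by (rule mult_left_mono) simp
  also have "\<dots> = ennreal c * set_nn_integral MQ0 Q (D_frac p \<alpha> f)"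
  proof -
    have "ennreal (1 / h ^ CARD('n)) * ennreal (c * h ^ CARD('n)) = ennreal (1 / h ^ CARD('n) * (c * h ^ CARD('n)))"
      by (rule ennreal_mult[symmetric]) (use h c in simp_all)
    also have "1 / h ^ CARD('n) * (c * h ^ CARD('n)) = c" using h by simp
    finally have "ennreal (1 / h ^ CARD('n)) * ennreal (c * h ^ CARD('n)) = ennreal c" .
    then show ?thesis by (simp only: mult.assoc[symmetric])
  qed
  finally show ?thesis unfolding c_def .
qed

text \<open>\<open>in_W\<close> asks only for measurability, whereas \<open>in_GaRo\<close> asks for
  integrability. \<open>Q0\<close> is itself a cube of side \<open>1\<close>, so at one point
  \<open>y\<close> with finite \<open>D_frac\<close> the difference \<open>f y - f x\<close> is
  integrable in \<open>x\<close>, and constants are integrable on \<open>Q0\<close>.\<close>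

lemma integrable_if_D_frac_finite:
  fixes f :: "real^'n::finite \<Rightarrow> real"
  assumes f: "f \<in> borel_measurable MQ0" and p: "1 < p" and \<alpha>: "0 < \<alpha>"
    and fin: "AE y in MQ0. D_frac p \<alpha> f y < \<infinity>"
  shows "integrable MQ0 f"
proof -
  interpret M: finite_measure "MQ0 :: (real^'n) measure" by (rule finite_measure_MQ0)
  \<comment> \<open>Positive total measure makes the almost-everywhere filter proper, so a property
    holding almost everywhere has a witness.\<close>
  have "emeasure MQ0 (space (MQ0 :: (real^'n) measure)) = 1"
    by (simp add: emeasure_MQ0)
  then have "ae_filter (MQ0 :: (real^'n) measure) \<noteq> bot"
    by (simp add: ae_filter_eq_bot_iff)
  moreover have "AE y in MQ0. y \<in> (Q0 :: (real^'n) set) \<and> D_frac p \<alpha> f y < \<infinity>"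
    using AE_conjI[OF AE_space fin] by simp
  ultimately have "\<exists>y. y \<in> (Q0 :: (real^'n) set) \<and> D_frac p \<alpha> f y < \<infinity>"
    by (rule eventually_happens')
  then obtain y where y: "y \<in> (Q0 :: (real^'n) set)" "D_frac p \<alpha> f y < \<infinity>"
    by (elim exE conjE)
  have "set_nn_integral lebesgue Q0 (\<lambda>x. ennreal \<bar>f y - f x\<bar>)
      \<le> ennreal ((1 + real CARD('n) powr (real CARD('n) + \<alpha> * p))) * D_frac p \<alpha> f y"
    using osc_le_D_frac[OF f p \<alpha> _ Q0_box _ y(1)] by simp
  also have "\<dots> < \<infinity>" using y(2) by (simp add: ennreal_mult_less_top)
  finally have "(\<integral>\<^sup>+x. ennreal (norm (f y - f x)) \<partial>MQ0) < \<infinity>"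
    by (simp add: nn_integral_restrict_space)
  then have "integrable MQ0 (\<lambda>x. f y - f x)"
    using f by (intro integrableI_bounded) auto
  then have "integrable MQ0 (\<lambda>x. f y - (f y - f x))"
    by (rule Bochner_Integration.integrable_diff[OF M.integrable_const])
  moreover have "(\<lambda>x. f y - (f y - f x)) = f" by (rule ext) simp
  ultimately show ?thesis by (simp only:)
qed

section \<open>Function norms and the operator norm of the Riesz potential\<close>

lemma function_norm_mono_AE:
  assumes "function_norm \<rho>" "f \<in> borel_measurable MQ0" "g \<in> borel_measurable MQ0"
    "AE x in MQ0. g x \<le> f x"
  shows "\<rho> g \<le> \<rho> f"
proof -
  have "\<forall>f \<in> borel_measurable MQ0. \<forall>g \<in> borel_measurable MQ0. (AE x in MQ0. g x \<le> f x) \<longrightarrow> \<rho> g \<le> \<rho> f"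
    using assms(1) unfolding function_norm_def by (elim conjE)
  from this[rule_format, OF assms(2-4)] show ?thesis .
qed

lemma function_norm_cong_AE:
  assumes \<rho>: "function_norm \<rho>" and m: "f \<in> borel_measurable MQ0" "g \<in> borel_measurable MQ0"
    and eq: "AE x in MQ0. f x = g x"
  shows "\<rho> f = \<rho> g"
proof (rule antisym)
  have "AE x in MQ0. f x \<le> g x" using eq by eventually_elim simp
  then show "\<rho> f \<le> \<rho> g" by (rule function_norm_mono_AE[OF \<rho> m(2,1)])
  have "AE x in MQ0. g x \<le> f x" using eq by eventually_elim simp
  then show "\<rho> g \<le> \<rho> f" by (rule function_norm_mono_AE[OF \<rho> m])
qed

text \<open>The axiom bounding integrals over sets of finite measure is applied to \<open>Q0\<close>
  itself. This supplies integrability of both the fractional derivative and the candidate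
  \<gamma>.\<close>

lemma function_norm_nn_integral_finite:
  fixes \<rho> :: "((real^'n::finite) \<Rightarrow> ennreal) \<Rightarrow> ennreal"
  assumes "function_norm \<rho>" and f: "f \<in> borel_measurable MQ0" and fin: "\<rho> f < \<infinity>"
  shows "(\<integral>\<^sup>+x. f x \<partial>MQ0) < \<infinity>"
proof -
  have "emeasure MQ0 (Q0 :: (real^'n) set) < \<infinity>"
    by (simp add: emeasure_MQ0)
  moreover have "(Q0 :: (real^'n) set) \<in> sets MQ0" by (rule subset_Q0_sets) auto
  moreover have "\<forall>A \<in> sets (MQ0::(real^'n) measure). emeasure MQ0 A < \<infinity> \<longrightarrow>
      (\<exists>C::real. \<forall>f \<in> borel_measurable MQ0. set_nn_integral MQ0 A f \<le> ennreal C * \<rho> f)"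
    using assms(1) unfolding function_norm_def by (elim conjE)
  ultimately obtain C :: real where
    "\<forall>f \<in> borel_measurable MQ0. set_nn_integral MQ0 (Q0 :: (real^'n) set) f \<le> ennreal C * \<rho> f"
    by meson
  from bspec[OF this f] have "set_nn_integral MQ0 (Q0 :: (real^'n) set) f \<le> ennreal C * \<rho> f" .
  also have "\<dots> < \<infinity>" using fin by (simp add: ennreal_mult_less_top)
  also have "set_nn_integral MQ0 (Q0 :: (real^'n) set) f = (\<integral>\<^sup>+x. f x \<partial>MQ0)"
    by (intro nn_integral_cong) simp
  finally show ?thesis .
qed

lemma in_space_cmult:
  assumes "function_norm \<rho>" "in_space \<rho> f" "0 \<le> c"
  shows "in_space \<rho> (\<lambda>x. c * f x)" "space_norm \<rho> (\<lambda>x. c * f x) = c * space_norm \<rho> f"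
proof -
  have m: "f \<in> borel_measurable MQ0" and fin: "\<rho> (\<lambda>x. ennreal \<bar>f x\<bar>) < \<infinity>"
    using assms(2) by (auto simp: in_space_def)
  have "\<rho> (\<lambda>x. ennreal c * ennreal \<bar>f x\<bar>) = ennreal c * \<rho> (\<lambda>x. ennreal \<bar>f x\<bar>)"
    using assms(1)[unfolded function_norm_def, THEN conjunct2, THEN conjunct1] m assms(3) by simp
  then have eq: "\<rho> (\<lambda>x. ennreal \<bar>c * f x\<bar>) = ennreal c * \<rho> (\<lambda>x. ennreal \<bar>f x\<bar>)"
    using assms(3) by (simp add: abs_mult ennreal_mult)
  show "in_space \<rho> (\<lambda>x. c * f x)"
    using m fin by (simp add: in_space_def eq ennreal_mult_less_top)
  show "space_norm \<rho> (\<lambda>x. c * f x) = c * space_norm \<rho> f"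
    using assms(3) by (simp add: space_norm_def eq enn2real_mult)
qed

text \<open>The infimum is itself an admissible bound: for fixed \<open>g\<close> of positive norm,
  every admissible constant is at least the quotient of the two norms, hence so is the infimum. For
  norm \<open>0\<close> any bound forces the left side to be \<open>0\<close>.\<close>

lemma space_norm_riesz_le:
  assumes "riesz_bounded \<alpha> \<rho>Y \<rho>X" "in_space \<rho>Y g"
  shows "space_norm \<rho>X (riesz \<alpha> g) \<le> riesz_opnorm \<alpha> \<rho>Y \<rho>X * space_norm \<rho>Y g"
proof -
  define S where "S = {K. 0 \<le> K \<and> (\<forall>g. in_space \<rho>Y g \<longrightarrow> space_norm \<rho>X (riesz \<alpha> g) \<le> K * space_norm \<rho>Y g)}"
  have n0: "0 \<le> space_norm \<rho>Y g" for g by (simp add: space_norm_def)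
  obtain K where K: "\<And>g. in_space \<rho>Y g \<Longrightarrow> space_norm \<rho>X (riesz \<alpha> g) \<le> K * space_norm \<rho>Y g"
    using assms(1) unfolding riesz_bounded_def by blast
  \<comment> \<open>\<open>riesz_bounded\<close> puts no sign condition on \<open>K\<close>, while
    \<open>S\<close> contains only nonnegative constants; the positive part shows that
    \<open>S\<close> is nonempty.\<close>
  have KS: "max K 0 \<in> S"
  proof -
    have "space_norm \<rho>X (riesz \<alpha> g) \<le> max K 0 * space_norm \<rho>Y g" if "in_space \<rho>Y g" for g
      by (rule order_trans[OF K[OF that] mult_right_mono[OF max.cobounded1 n0]])
    then show ?thesis by (simp add: S_def)
  qed
  show ?thesis
  proof (cases "space_norm \<rho>Y g = 0")
    case True
    then show ?thesis using K[OF assms(2)] by simp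
  next
    case False
    then have pos: "0 < space_norm \<rho>Y g" using n0[of g] by simp
    have "space_norm \<rho>X (riesz \<alpha> g) / space_norm \<rho>Y g \<le> Inf S"
    proof (rule cInf_greatest)
      fix L assume "L \<in> S"
      then show "space_norm \<rho>X (riesz \<alpha> g) / space_norm \<rho>Y g \<le> L"
        using assms(2) pos by (simp add: S_def divide_simps)
    qed (use KS in auto)
    then show ?thesis
      using pos by (simp add: riesz_opnorm_def S_def pos_divide_le_eq)
  qed
qed

section \<open>The embedding and its constant\<close>

theorem theorem4p3:
  fixes \<alpha> p :: real
  assumes "0 < \<alpha>" and "\<alpha> < 1"
    and "1 < p" and "p < real CARD('n::finite) / \<alpha>"
  shows "\<exists>C>0. \<forall>(\<rho>X :: ((real^'n) \<Rightarrow> ennreal) \<Rightarrow> ennreal) \<rho>Y.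
     ri_space \<rho>X \<longrightarrow> ri_space \<rho>Y \<longrightarrow> riesz_bounded \<alpha> \<rho>Y \<rho>X \<longrightarrow>
     (\<forall>f. in_W \<rho>Y p \<alpha> f \<longrightarrow>
        in_GaRo \<rho>X f \<and>
        (\<lambda>z. C * riesz \<alpha> (\<lambda>y. enn2real (D_frac p \<alpha> f y)) z) \<in> Gamma_set \<rho>X f \<and>
        GaRo_norm \<rho>X f \<le> C * riesz_opnorm \<alpha> \<rho>Y \<rho>X * W_norm \<rho>Y p \<alpha> f)"
proof -
  define N where "N = real CARD('n)"
  \<comment> \<open>\<open>A\<close> is the constant of \<open>double_osc_le_D_frac\<close>. The
    extra factor in \<open>C\<close> compensates the power \<open>N powr (\<alpha> - N)\<close> in
    \<open>nn_integral_riesz_ge\<close>. Both are fixed before the spaces and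
    \<open>f\<close>.\<close>
  define A where "A = 1 + N powr (N + \<alpha> * p)"
  define C where "C = A * N powr (N - \<alpha>)"
  have N: "0 < N" unfolding N_def by simp
  have A: "0 < A" unfolding A_def by (simp add: add_pos_nonneg)
  have C: "0 < C" unfolding C_def using A N by simp
  show ?thesis
  proof (intro exI[of _ C] conjI[OF C] allI impI)
    fix \<rho>X \<rho>Y :: "((real^'n) \<Rightarrow> ennreal) \<Rightarrow> ennreal" and f :: "real^'n \<Rightarrow> real"
    assume riX: "ri_space \<rho>X" and riY: "ri_space \<rho>Y" and bd: "riesz_bounded \<alpha> \<rho>Y \<rho>X"
      and W: "in_W \<rho>Y p \<alpha> f"
    have nX: "function_norm \<rho>X" and nY: "function_norm \<rho>Y"
      using riX riY by (auto simp: ri_space_def)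
    define D where "D = D_frac p \<alpha> f"
    \<comment> \<open>\<open>riesz\<close> acts on real functions, so the extended-valued
      \<open>D\<close> is replaced by \<open>g\<close>. Finite norm in \<open>Y\<close> makes
      \<open>D\<close> integrable, hence finite almost everywhere, so norms and integrals are
      unchanged.\<close>
    define g where "g = (\<lambda>y. enn2real (D y))"
    have f: "f \<in> borel_measurable MQ0" and Dfin: "\<rho>Y D < \<infinity>"
      using W by (auto simp: in_W_def D_def)
    have Dm: "D \<in> borel_measurable MQ0" unfolding D_def by (rule D_frac_measurable[OF f])
    have gm: "g \<in> borel_measurable MQ0" unfolding g_def using Dm by measurable
    have g0: "0 \<le> g y" for y by (simp add: g_def)
    have "(\<integral>\<^sup>+y. D y \<partial>MQ0) < \<infinity>"
      by (rule function_norm_nn_integral_finite[OF nY Dm Dfin])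
    then have D_AE: "AE y in MQ0. D y < \<infinity>"
      using nn_integral_noteq_infinite[OF Dm] by (simp add: less_top)
    then have gD: "AE y in MQ0. ennreal (g y) = D y"
      by eventually_elim (simp add: g_def)
    have \<rho>g: "\<rho>Y (\<lambda>y. ennreal \<bar>g y\<bar>) = \<rho>Y D"
      using gD gm Dm g0 by (intro function_norm_cong_AE[OF nY]) auto
    have gY: "in_space \<rho>Y g" using gm Dfin by (simp add: in_space_def \<rho>g)
    have Wg: "space_norm \<rho>Y g = W_norm \<rho>Y p \<alpha> f"
      by (simp add: space_norm_def W_norm_def \<rho>g D_def)
    have gfin: "(\<integral>\<^sup>+y. ennreal (g y) \<partial>MQ0) < \<infinity>"
      using \<open>(\<integral>\<^sup>+y. D y \<partial>MQ0) < \<infinity>\<close> nn_integral_cong_AE[OF gD] by simp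
    define \<gamma> where "\<gamma> = (\<lambda>z. C * riesz \<alpha> g z)"
    have rX: "in_space \<rho>X (riesz \<alpha> g)" using bd gY unfolding riesz_bounded_def by blast
    then have rm: "riesz \<alpha> g \<in> borel_measurable MQ0" by (simp add: in_space_def)
    have \<gamma>X: "in_space \<rho>X \<gamma>" and \<gamma>n: "space_norm \<rho>X \<gamma> = C * space_norm \<rho>X (riesz \<alpha> g)"
      unfolding \<gamma>_def using in_space_cmult[OF nX rX, of C] C by auto
    have \<gamma>m: "\<gamma> \<in> borel_measurable MQ0" using \<gamma>X by (simp add: in_space_def)
    have \<gamma>0: "0 \<le> \<gamma> z" for z
      unfolding \<gamma>_def using C riesz_nonneg[of g \<alpha> z] g0 by simp
    have "\<rho>X (\<lambda>z. ennreal (\<gamma> z)) < \<infinity>" using \<gamma>X \<gamma>0 by (simp add: in_space_def)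
    then have \<gamma>fin: "(\<integral>\<^sup>+z. ennreal (\<gamma> z) \<partial>MQ0) < \<infinity>"
      using \<gamma>m by (intro function_norm_nn_integral_finite[OF nX]) auto
    have cube: "ennreal (1 / measure lebesgue S) *
        set_nn_integral lebesgue S (\<lambda>x. set_nn_integral lebesgue S (\<lambda>y. ennreal \<bar>f x - f y\<bar>))
        \<le> set_nn_integral MQ0 S (\<lambda>z. ennreal (\<gamma> z))" if sub: "subcube S" for S
    proof -
      obtain a h where h: "0 < h" and S: "S = box a (a + h *\<^sub>R One)" "S \<subseteq> Q0"
        using sub unfolding subcube_def by blast
      have Ss: "S \<in> sets MQ0" using S by (intro subset_Q0_sets) auto
      have hN: "h ^ CARD('n) = h powr N" using h by (simp add: N_def powr_realpow)
      define G where "G = set_nn_integral MQ0 S (\<lambda>y. ennreal (g y))"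
      have GD: "set_nn_integral MQ0 S D = G"
        unfolding G_def using gD by (intro nn_integral_cong_AE) auto
      \<comment> \<open>The powers of \<open>N\<close> cancel and those of \<open>h\<close> combine
        to \<open>h powr \<alpha>\<close>, so the upper bound for the oscillation is exactly
        \<open>C\<close> times the lower bound for the potential.\<close>
      have "C * ((N * h) powr (\<alpha> - N) * h powr N)
          = A * (N powr (N - \<alpha>) * N powr (\<alpha> - N)) * (h powr (\<alpha> - N) * h powr N)"
        unfolding C_def using N h by (simp add: powr_mult)
      also have "\<dots> = A * h powr \<alpha>"
        using N by (simp flip: powr_add)
      finally have const: "C * ((N * h) powr (\<alpha> - N) * h powr N) = A * h powr \<alpha>" .
      have "ennreal (1 / measure lebesgue S) *
          set_nn_integral lebesgue S (\<lambda>x. set_nn_integral lebesgue S (\<lambda>y. ennreal \<bar>f x - f y\<bar>))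
          \<le> ennreal (A * h powr \<alpha>) * G"
        using double_osc_le_D_frac[OF f assms(3,1) h S] GD by (simp add: A_def N_def D_def)
      also have "\<dots> = ennreal C * (ennreal ((N * h) powr (\<alpha> - N) * h ^ CARD('n)) * G)"
        unfolding hN const[symmetric] using C by (subst ennreal_mult) (auto simp: mult.assoc)
      also have "\<dots> \<le> ennreal C * set_nn_integral MQ0 S (\<lambda>z. ennreal (riesz \<alpha> g z))"
        unfolding G_def N_def
        by (intro mult_left_mono nn_integral_riesz_ge[OF assms(1,2) gm g0 gfin h S]) simp
      also have "\<dots> = (\<integral>\<^sup>+z. ennreal C * (ennreal (riesz \<alpha> g z) * indicator S z) \<partial>MQ0)"
        using rm Ss
        by (intro nn_integral_cmult[symmetric] borel_measurable_times_ennreal borel_measurable_indicator) auto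
      also have "\<dots> = set_nn_integral MQ0 S (\<lambda>z. ennreal (\<gamma> z))"
        unfolding \<gamma>_def using C riesz_nonneg[of g \<alpha>] g0
        by (intro nn_integral_cong) (auto simp: ennreal_mult mult.assoc)
      finally show ?thesis .
    qed
    have \<gamma>\<Gamma>: "\<gamma> \<in> Gamma_set \<rho>X f"
      unfolding Gamma_set_def using \<gamma>X GaRo_ineqI[OF \<gamma>m \<gamma>0 \<gamma>fin _ cube] by blast
    have "integrable MQ0 f"
      using integrable_if_D_frac_finite[OF f assms(3,1)] D_AE by (simp add: D_def)
    then have 1: "in_GaRo \<rho>X f" unfolding in_GaRo_def using \<gamma>\<Gamma> by blast
    have "GaRo_norm \<rho>X f \<le> space_norm \<rho>X \<gamma>"
      unfolding GaRo_norm_def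
      by (intro cInf_lower imageI \<gamma>\<Gamma> bdd_belowI[of _ 0]) (auto simp: space_norm_def)
    also have "\<dots> \<le> C * (riesz_opnorm \<alpha> \<rho>Y \<rho>X * space_norm \<rho>Y g)"
      unfolding \<gamma>n using C space_norm_riesz_le[OF bd gY] by simp
    finally have 2: "GaRo_norm \<rho>X f \<le> C * riesz_opnorm \<alpha> \<rho>Y \<rho>X * W_norm \<rho>Y p \<alpha> f"
      by (simp add: Wg mult.assoc)
    show "in_GaRo \<rho>X f \<and>
        (\<lambda>z. C * riesz \<alpha> (\<lambda>y. enn2real (D_frac p \<alpha> f y)) z) \<in> Gamma_set \<rho>X f \<and>
        GaRo_norm \<rho>X f \<le> C * riesz_opnorm \<alpha> \<rho>Y \<rho>X * W_norm \<rho>Y p \<alpha> f"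
      using 1 2 \<gamma>\<Gamma> by (simp add: \<gamma>_def g_def D_def)
  qed
qed

end
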